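(* Let $L>0$, $\gamma>0$ and $\beta\ge0$, and set $$h_{\mathrm{Lyap}}=\frac{\gamma-L\beta+\sqrt{(\gamma-L\beta)^2+4L\beta\gamma/(1+\beta\gamma)}}{L},\qquad h_{\mathrm{quad}}=\frac{\gamma-L\beta+\sqrt{(\gamma-L\beta)^2+4L}}{L}.$$ Then $0<h_{\mathrm{Lyap}}<h_{\mathrm{quad}}$, and $$h_{\mathrm{quad}}-h_{\mathrm{Lyap}}=\frac{4}{(1+\beta\gamma)\left[\sqrt{(\gamma-L\beta)^2+4L}+\sqrt{(\gamma-L\beta)^2+\dfrac{4L\beta\gamma}{1+\beta\gamma}}\right]}.$$ If instead $\gamma=0<L$ and $\beta>0$, then the matrix $$M_h=\begin{pmatrix}h\gamma-\frac{Lh^2}{2}&-\frac{Lh\beta}{2}\\-\frac{Lh\beta}{2}&\frac12+\frac{\beta}{h}+\frac{\beta\gamma}{2}-\frac{L\beta^2}{2}\end{pmatrix}$$ is not positive semidefinite for any $h>0$, whereas the interval $0<h<h_{\mathrm{quad}}$ (with $h_{\mathrm{quad}}$ given by the same formula with $\gamma=0$) is nonempty.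
   Context: In the paper, $M_h$ is the matrix of the quadratic form in the discrete energy estimate, $h_{\mathrm{Lyap}}$ is the largest $h$ for which $M_h$ is positive semidefinite when $L,\gamma>0$, and $(0,h_{\mathrm{quad}})$ is the interval of step sizes for which the frictionless iteration $v_{k+1}=\frac{1}{1+h\gamma}(v_k-hQ(z_k+\beta v_k))$, $z_{k+1}=z_k+hv_{k+1}$, with $Q$ positive definite self-adjoint and $\max\sigma(Q)=L$, is Schur stable uniformly over the spectral modes. These interpretations are not needed for the claim. *)

theory Defs
  imports "HOL-Analysis.Analysis"
begin

definition h_Lyap :: "real \<Rightarrow> real \<Rightarrow> real \<Rightarrow> real" where
  "h_Lyap L \<gamma> \<beta> =
     (\<gamma> - L * \<beta> + sqrt ((\<gamma> - L * \<beta>)\<^sup>2 + 4 * L * \<beta> * \<gamma> / (1 + \<beta> * \<gamma>))) / L"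

definition h_quad :: "real \<Rightarrow> real \<Rightarrow> real \<Rightarrow> real" where
  "h_quad L \<gamma> \<beta> = (\<gamma> - L * \<beta> + sqrt ((\<gamma> - L * \<beta>)\<^sup>2 + 4 * L)) / L"

definition M_mat :: "real \<Rightarrow> real \<Rightarrow> real \<Rightarrow> real \<Rightarrow> real^2^2" where
  "M_mat L \<gamma> \<beta> h = vector
     [vector [h * \<gamma> - L * h\<^sup>2 / 2, - (L * h * \<beta> / 2)],
      vector [- (L * h * \<beta> / 2), 1 / 2 + \<beta> / h + \<beta> * \<gamma> / 2 - L * \<beta>\<^sup>2 / 2]]"

definition pos_semidef :: "real^'n^'n \<Rightarrow> bool" where
  "pos_semidef A \<longleftrightarrow> transpose A = A \<and> (\<forall>v. 0 \<le> v \<bullet> (A *v v))"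

(* By symmetry, failure of pos_semidef for M_mat always means that
   the quadratic form takes a negative value. *)
lemma transpose_M_mat: "transpose (M_mat L \<gamma> \<beta> h) = M_mat L \<gamma> \<beta> h"
  by (simp add: M_mat_def transpose_def vec_eq_iff forall_2)

end

theory Submission
  imports Defs
begin

text \<open>Put a = \<gamma> - L * \<beta>. Both step sizes have the form (a + sqrt (a^2 + c)) / L,
  with c = 4 * L for \<open>h_quad\<close> and c = 4 * L * \<beta> * \<gamma> / (1 + \<beta> *
  \<gamma>) for \<open>h_Lyap\<close>. Positivity, the strict order and the gap therefore reduce to
  facts about square roots sharing the same a^2: \<open>add_sqrt_square_add_pos\<close> gives
  positivity, and multiplying by the conjugate gives the gap in \<open>h_quad_minus_h_Lyap\<close>.
  When \<gamma> = 0, the first diagonal entry of the matrix is negative, which rules out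
  semidefiniteness, while c = 4 * L still makes \<open>h_quad\<close> positive and the interval
  nonempty.\<close>

text \<open>For a > 0 the root only has to be nonnegative. Otherwise c > 0, and the root strictly
  exceeds \<bar>a\<bar>.\<close>

lemma add_sqrt_square_add_pos:
  fixes a c :: real
  assumes "c \<ge> 0" "a > 0 \<or> c > 0"
  shows "0 < a + sqrt (a\<^sup>2 + c)"
proof (cases "a > 0")
  case True
  then show ?thesis
    using assms(1) by (simp add: add_pos_nonneg)
next
  case False
  then have "\<bar>a\<bar> < sqrt (a\<^sup>2 + c)"
    using assms(2) by (intro real_less_rsqrt) simp
  then show ?thesis by linarith
qed

lemma h_Lyap_pos:
  assumes "L > 0" "\<gamma> > 0" "\<beta> \<ge> 0"
  shows "0 < h_Lyap L \<gamma> \<beta>"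
proof -
  define c where "c = 4 * L * \<beta> * \<gamma> / (1 + \<beta> * \<gamma>)"
  \<comment> \<open>If \<beta> = 0 then c vanishes, but the linear part is \<gamma> > 0; if \<beta>
    > 0 then c > 0.\<close>
  have "c \<ge> 0" "\<gamma> - L * \<beta> > 0 \<or> c > 0"
    using assms by (auto simp: c_def order_le_less add_pos_pos)
  then show ?thesis
    using assms(1) add_sqrt_square_add_pos[of c "\<gamma> - L * \<beta>"]
    by (simp add: h_Lyap_def c_def)
qed

lemma h_quad_pos:
  assumes "L > 0"
  shows "0 < h_quad L \<gamma> \<beta>"
  using assms add_sqrt_square_add_pos[of "4 * L" "\<gamma> - L * \<beta>"]
  by (simp add: h_quad_def)

lemma h_quad_minus_h_Lyap:
  assumes "L > 0" "\<beta> * \<gamma> \<ge> 0"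
  shows "h_quad L \<gamma> \<beta> - h_Lyap L \<gamma> \<beta> =
    4 / ((1 + \<beta> * \<gamma>) *
         (sqrt ((\<gamma> - L * \<beta>)\<^sup>2 + 4 * L) +
          sqrt ((\<gamma> - L * \<beta>)\<^sup>2 + 4 * L * \<beta> * \<gamma> / (1 + \<beta> * \<gamma>))))"
proof -
  define c where "c = 4 * L * \<beta> * \<gamma> / (1 + \<beta> * \<gamma>)"
  define s where "s = sqrt ((\<gamma> - L * \<beta>)\<^sup>2 + 4 * L)"
  define t where "t = sqrt ((\<gamma> - L * \<beta>)\<^sup>2 + c)"
  have p: "1 + \<beta> * \<gamma> > 0"
    using assms(2) by linarith
  have "c \<ge> 0"
    using assms by (simp add: c_def mult.assoc)
  then have t: "t \<ge> 0" "t\<^sup>2 = (\<gamma> - L * \<beta>)\<^sup>2 + c"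
    by (simp_all add: t_def)
  have s: "s > 0" "s\<^sup>2 = (\<gamma> - L * \<beta>)\<^sup>2 + 4 * L"
    using assms(1) by (simp_all add: s_def add_nonneg_pos)
  \<comment> \<open>The common square cancels in s^2 - t^2, leaving 4 * L - c; the factor 1 +
    \<beta> * \<gamma> of the gap comes from 1 - \<beta>\<gamma> / (1 + \<beta>\<gamma>).\<close>
  have "4 * L - c = 4 * L / (1 + \<beta> * \<gamma>)"
    using p by (simp add: c_def field_simps)
  moreover have "(s - t) * (s + t) = 4 * L - c"
    using s(2) t(2) by (simp add: algebra_simps power2_eq_square)
  ultimately have "(s - t) * (s + t) * (1 + \<beta> * \<gamma>) = 4 * L"
    using p by simp
  moreover have "s + t > 0"
    using s(1) t(1) by linarith
  ultimately have "(s - t) / L = 4 / ((1 + \<beta> * \<gamma>) * (s + t))"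
    using p assms(1) by (simp add: frac_eq_eq mult_ac)
  moreover have "h_quad L \<gamma> \<beta> - h_Lyap L \<gamma> \<beta> = (s - t) / L"
    by (simp add: h_quad_def h_Lyap_def s_def t_def c_def diff_divide_distrib[symmetric])
  ultimately show ?thesis
    by (simp add: s_def t_def c_def)
qed

text \<open>Since \<beta>\<gamma> / (1 + \<beta>\<gamma>) < 1, the radicands compare strictly, and
  the square root is strictly increasing.\<close>

lemma h_Lyap_less_h_quad:
  assumes "L > 0" "\<beta> * \<gamma> \<ge> 0"
  shows "h_Lyap L \<gamma> \<beta> < h_quad L \<gamma> \<beta>"
proof -
  have "4 * L * \<beta> * \<gamma> / (1 + \<beta> * \<gamma>) < 4 * L"
    using assms by (simp add: pos_divide_less_eq add_pos_nonneg algebra_simps)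
  then show ?thesis
    using assms(1) by (simp add: h_quad_def h_Lyap_def divide_strict_right_mono)
qed

text \<open>A diagonal entry is the value of the quadratic form at a standard basis vector.\<close>

lemma pos_semidef_diagonal_nonneg:
  assumes "pos_semidef A"
  shows "0 \<le> A $ i $ i"
proof -
  have "0 \<le> axis i 1 \<bullet> (A *v axis i 1)"
    using assms by (simp add: pos_semidef_def)
  then show ?thesis
    by (simp add: matrix_vector_mul_component inner_axis inner_axis')
qed

text \<open>Without friction the term h * \<gamma> disappears, so the first diagonal entry is -L *
  h^2 / 2 < 0, whatever \<beta> is.\<close>

lemma not_pos_semidef_M_mat_zero:
  assumes "L > 0" "h > 0"
  shows "\<not> pos_semidef (M_mat L 0 \<beta> h)"
proof
  assume "pos_semidef (M_mat L 0 \<beta> h)"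
  from pos_semidef_diagonal_nonneg[OF this, of 1] have "L * h\<^sup>2 \<le> 0"
    by (simp add: M_mat_def)
  with assms show False
    by (simp add: mult_le_0_iff)
qed

theorem proposition5p7:
  fixes L \<gamma> \<beta> :: real
  shows "(L > 0 \<and> \<gamma> > 0 \<and> \<beta> \<ge> 0 \<longrightarrow>
            0 < h_Lyap L \<gamma> \<beta> \<and> h_Lyap L \<gamma> \<beta> < h_quad L \<gamma> \<beta> \<and>
            h_quad L \<gamma> \<beta> - h_Lyap L \<gamma> \<beta> =
              4 / ((1 + \<beta> * \<gamma>) *
                   (sqrt ((\<gamma> - L * \<beta>)\<^sup>2 + 4 * L) +
                    sqrt ((\<gamma> - L * \<beta>)\<^sup>2 + 4 * L * \<beta> * \<gamma> / (1 + \<beta> * \<gamma>))))) \<and>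
         (\<gamma> = 0 \<and> 0 < L \<and> \<beta> > 0 \<longrightarrow>
            (\<forall>h>0. \<not> pos_semidef (M_mat L \<gamma> \<beta> h)) \<and>
            {0<..<h_quad L \<gamma> \<beta>} \<noteq> {})"
  using h_Lyap_pos[of L \<gamma> \<beta>] h_Lyap_less_h_quad[of L \<beta> \<gamma>] h_quad_minus_h_Lyap[of L \<beta> \<gamma>]
    h_quad_pos[of L \<gamma> \<beta>] not_pos_semidef_M_mat_zero[of L]
  by (auto simp: greaterThanLessThan_empty_iff)

end
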